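(* Let $G$ be a connected graph of order $n$, and write the characteristic polynomial of its distance Laplacian matrix as $p_{\mathcal D^L(G)}(x)=\det(xI-\mathcal D^L(G))=x^n+\delta^L_{n-1}x^{n-1}+\dots+\delta^L_{1}x$, with $\delta^L_n=1$. Then the sequence $\delta^L_{1},\dots,\delta^L_{n-1},\delta^L_{n}$ is log-concave and the sequence $|\delta^L_{1}|,\dots,|\delta^L_{n}|$ is unimodal. In fact, $|\delta^L_{1}|\geq |\delta^L_{2}|\geq \dots \geq |\delta^L_{n}|$.
   Context: All graphs are finite, simple and undirected. For a connected graph $G$ with vertices $v_1,\dots,v_n$, the distance matrix $\mathcal D(G)$ has $(i,j)$-entry $d(v_i,v_j)$ (the length of a shortest $v_i,v_j$-path). The transmission of a vertex $v$ is $t(v)=\sum_{w\in V(G)}d(v,w)$, and the distance Laplacian matrix is $\mathcal D^L(G)=\operatorname{diag}(t(v_1),\dots,t(v_n))-\mathcal D(G)$. A sequence $a_1,\dots,a_m$ is log-concave if $a_j^2\ge a_{j-1}a_{j+1}$ for $2\le j\le m-1$, and unimodal if there is $k$ with $a_{i-1}\le a_i$ for $i\le k$ and $a_i\ge a_{i+1}$ for $i\ge k$. *)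

theory Defs
  imports
    "Graph_Theory.Digraph_Component"
    "Graph_Theory.Shortest_Path"
    "Jordan_Normal_Form.Char_Poly"
begin

text \<open>
  Finite simple undirected graphs are those satisfying the predicate \<^const>\<open>graph\<close>: finite
  symmetric digraphs without loops and parallel arcs, an edge being a pair of opposite arcs.
  As a list of arcs, a path has its number of edges as its length. The value of
  \<open>graph_dist G u v\<close> is meaningful only if there is a path from \<open>u\<close> to \<open>v\<close>.
\<close>

definition graph_dist :: "('a, 'b) pre_digraph \<Rightarrow> 'a \<Rightarrow> 'a \<Rightarrow> nat" where
  "graph_dist G u v = (LEAST k. \<exists>p. pre_digraph.apath G u p v \<and> length p = k)"

text \<open>Agreement with the library's \<open>\<mu>\<close> for unit weights.\<close>

lemma (in wf_digraph) graph_dist_eq_mu: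
  assumes "u \<rightarrow>\<^sup>* v"
  shows "\<mu> (\<lambda>_. 1) u v = ereal (real (graph_dist G u v))"
proof -
  have cost: "awalk_cost (\<lambda>_. 1) p = real (length p)" for p :: "'b awalk"
    by (induction p) auto
  have ex: "\<exists>k p. apath u p v \<and> length p = k"
    using assms reachable_apath by blast
  obtain p where p: "apath u p v" "length p = graph_dist G u v"
    using LeastI_ex[OF ex] unfolding graph_dist_def by blast
  have le: "graph_dist G u v \<le> length q" if "awalk u q v" for q
  proof -
    have "apath u (awalk_to_apath q) v"
      using that by (rule apath_awalk_to_apath)
    then have "graph_dist G u v \<le> length (awalk_to_apath q)"
      unfolding graph_dist_def by (blast intro: Least_le)
    also have "\<dots> \<le> length q"
      using that
    proof (induction rule: awalk_to_apath_induct)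
      case (path p)
      then have "awalk_to_apath p = p"
        by (subst awalk_to_apath.simps) (auto simp: apath_def)
      then show ?case by simp
    next
      case (decomp p q r s)
      have "awalk_to_apath p = awalk_to_apath (q @ s)"
        using decomp by (intro step_awalk_to_apath) auto
      moreover have "p = q @ r @ s"
        using decomp by (auto elim: awalk_cyc_decompE)
      ultimately show ?case using decomp by auto
    qed
    finally show ?thesis .
  qed
  show ?thesis
    unfolding \<mu>_def cost
  proof (rule antisym)
    show "(INF q\<in>{q. awalk u q v}. ereal (real (length q))) \<le> ereal (real (graph_dist G u v))"
      using p by (intro INF_lower2[of p]) (auto simp: apath_def)
  next
    show "ereal (real (graph_dist G u v)) \<le> (INF q\<in>{q. awalk u q v}. ereal (real (length q)))"
      using le by (auto intro!: INF_greatest)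
  qed
qed

definition transmission :: "('a, 'b) pre_digraph \<Rightarrow> 'a \<Rightarrow> nat" where
  "transmission G v = (\<Sum>w\<in>verts G. graph_dist G v w)"

text \<open>The matrices depend on an enumeration \<open>vs\<close> of the vertices, indexed from 0.\<close>

definition distance_matrix :: "('a, 'b) pre_digraph \<Rightarrow> 'a list \<Rightarrow> real mat" where
  "distance_matrix G vs =
     mat (length vs) (length vs) (\<lambda>(i, j). real (graph_dist G (vs ! i) (vs ! j)))"

definition distance_laplacian :: "('a, 'b) pre_digraph \<Rightarrow> 'a list \<Rightarrow> real mat" where
  "distance_laplacian G vs =
     mat_diag (length vs) (\<lambda>i. real (transmission G (vs ! i))) - distance_matrix G vs"

text \<open>Both predicates concern the finite sequence \<open>a 1, \<dots>, a m\<close>.\<close>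

definition log_concave_seq :: "nat \<Rightarrow> (nat \<Rightarrow> real) \<Rightarrow> bool" where
  "log_concave_seq m a \<longleftrightarrow> (\<forall>j. 2 \<le> j \<and> j \<le> m - 1 \<longrightarrow> (a j)\<^sup>2 \<ge> a (j - 1) * a (j + 1))"

definition unimodal_seq :: "nat \<Rightarrow> (nat \<Rightarrow> real) \<Rightarrow> bool" where
  "unimodal_seq m a \<longleftrightarrow>
     (\<exists>k\<in>{1..m}. (\<forall>i. 2 \<le> i \<and> i \<le> k \<longrightarrow> a (i - 1) \<le> a i) \<and>
                 (\<forall>i. k \<le> i \<and> i < m \<longrightarrow> a i \<ge> a (i + 1)))"

end

theory Submission
  imports Defs
begin

text \<open>
  Since distinct vertices have distance at least 1, the quadratic form of the distance Laplacian
  \<open>L\<close> dominates that of the Laplacian of the complete graph. Hence, with \<open>J\<close> the all-ones matrix,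
  every eigenvalue of \<open>L + J\<close> is real and at least \<open>n\<close>. Row operations give
  \<open>p\<^sub>L(x) = x r(x)\<close> and \<open>p\<^sub>L\<^sub>+\<^sub>J(x) = (x - n) r(x)\<close> with the same \<open>r\<close>, so \<open>r\<close> is a product of \<open>n - 1\<close>
  factors \<open>x - a\<close> with \<open>a \<ge> n\<close>. Nonnegative roots make the absolute values of the coefficients
  of \<open>r\<close> log-concave, and \<open>a \<ge> n\<close> makes them decreasing: for elementary symmetric functions,
  \<open>(j + 1) e\<^sub>j\<^sub>+\<^sub>1 \<ge> (n - 1 - j) n e\<^sub>j\<close>.
\<close>

section \<open>Graph distances\<close>

lemma (in sym_digraph) awalk_reverse:
  assumes "awalk u p v"
  obtains q where "awalk v q u" "length q = length p"
proof -
  have "\<exists>q. awalk v q u \<and> length q = length p"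
    using assms
  proof (induction p arbitrary: u)
    case Nil
    then show ?case by (auto simp: awalk_Nil_iff)
  next
    case (Cons e p)
    then have e: "e \<in> arcs G" "u = tail G e" and p: "awalk (head G e) p v"
      by (auto simp: awalk_Cons_iff)
    obtain q where q: "awalk v q (head G e)" "length q = length p"
      using Cons.IH[OF p] by blast
    obtain f where f: "f \<in> arcs G" "tail G f = head G e" "head G f = u"
      using e sym_arcs unfolding symmetric_conv by metis
    have "awalk (head G e) [f] u"
      using f by (auto simp: awalk_simps)
    then have "awalk v (q @ [f]) u"
      using q(1) by (metis awalk_appendI)
    then show ?case using q(2) by (metis length_append_singleton length_Cons)
  qed
  then show thesis using that by blast
qed

text \<open>\<open>graph_dist\<close> minimises over paths only, but \<mu> for unit weights is an
  infimum over all walks. With the bound for walks, symmetry of the distance needs only the reversed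
  walk, not a proof that it is again a path.\<close>

lemma (in wf_digraph) graph_dist_le_awalk:
  assumes "awalk u p v"
  shows "graph_dist G u v \<le> length p"
proof -
  have "awalk_cost (\<lambda>_. 1) p = real (length p)" by (induction p) auto
  moreover have "u \<rightarrow>\<^sup>* v" using assms by (rule reachable_awalkI)
  ultimately show ?thesis
    using min_cost_le_walk_cost[OF assms, of "\<lambda>_. 1"] graph_dist_eq_mu[of u v] by simp
qed

lemma (in wf_digraph) graph_dist_awalk:
  assumes "u \<rightarrow>\<^sup>* v"
  obtains p where "awalk u p v" "length p = graph_dist G u v"
proof -
  have "\<exists>k p. apath u p v \<and> length p = k"
    using assms reachable_apath by blast
  from LeastI_ex[OF this] show thesis
    unfolding graph_dist_def[symmetric] using that by (auto simp: apath_def)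
qed

lemma (in sym_digraph) graph_dist_commute:
  assumes "u \<rightarrow>\<^sup>* v"
  shows "graph_dist G u v = graph_dist G v u"
proof (rule antisym)
  show "graph_dist G u v \<le> graph_dist G v u"
    using assms by (metis graph_dist_awalk awalk_reverse graph_dist_le_awalk symmetric_reachable')
  show "graph_dist G v u \<le> graph_dist G u v"
    using assms by (metis graph_dist_awalk awalk_reverse graph_dist_le_awalk)
qed

lemma (in wf_digraph) graph_dist_pos:
  assumes "u \<rightarrow>\<^sup>* v" "u \<noteq> v"
  shows "1 \<le> graph_dist G u v"
proof -
  obtain p where "awalk u p v" "length p = graph_dist G u v"
    using assms(1) graph_dist_awalk by blast
  then show ?thesis using assms(2) by (cases p) (auto simp: awalk_Nil_iff)
qed

section \<open>Determinants with constant column sums\<close>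

text \<open>Adding all rows to the last one makes it constantly \<open>c\<close>, and
  \<open>c\<close> factors out. As the matrix identity \<open>E * A = D * R\<close>, with
  \<open>E\<close> the row operation and \<open>D\<close> the scaling of the last row, this never
  divides by \<open>c\<close>.\<close>

lemma det_const_col_sums:
  fixes A :: "'a :: idom mat"
  assumes A: "A \<in> carrier_mat (Suc m) (Suc m)"
    and c: "\<And>j. j < Suc m \<Longrightarrow> (\<Sum>i<Suc m. A $$ (i, j)) = c"
  shows "det A = c * det (mat (Suc m) (Suc m) (\<lambda>(i, j). if i = m then 1 else A $$ (i, j)))"
proof -
  define R where "R = mat (Suc m) (Suc m) (\<lambda>(i, j). if i = m then 1 else A $$ (i, j))"
  define E where "E = mat (Suc m) (Suc m) (\<lambda>(i, j). if i = m \<or> i = j then 1 else 0 :: 'a)"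
  define D where "D = mat (Suc m) (Suc m) (\<lambda>(i, j). if i = j then if i = m then c else 1 else 0)"
  have carr: "E \<in> carrier_mat (Suc m) (Suc m)" "D \<in> carrier_mat (Suc m) (Suc m)"
    "R \<in> carrier_mat (Suc m) (Suc m)" by (auto simp: E_def D_def R_def)
  have dE: "det E = 1"
    by (subst det_lower_triangular[OF _ carr(1)])
      (auto simp: E_def prod_list_diag_prod intro!: prod.neutral)
  have dD: "det D = c"
    by (subst det_lower_triangular[OF _ carr(2)])
      (auto simp: D_def prod_list_diag_prod)
  have "E * A = D * R"
  proof (rule eq_matI)
    fix i j assume "i < dim_row (D * R)" "j < dim_col (D * R)"
    then have ij: "i < Suc m" "j < Suc m" using carr by auto
    have "(E * A) $$ (i, j) = (\<Sum>k<Suc m. (if i = m \<or> i = k then 1 else 0) * A $$ (k, j))"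
      using ij A by (simp add: times_mat_def scalar_prod_def E_def atLeast0LessThan del: sum.lessThan_Suc)
    also have "\<dots> = (if i = m then c else A $$ (i, j))"
    proof (cases "i = m")
      case True
      then show ?thesis using c[OF ij(2)] by simp
    next
      case False
      have "(\<Sum>k<Suc m. (if i = m \<or> i = k then 1 else 0) * A $$ (k, j))
          = (\<Sum>k<Suc m. if i = k then A $$ (k, j) else 0)"
        using False by (intro sum.cong) auto
      then show ?thesis using False ij by (simp del: sum.lessThan_Suc)
    qed
    also have "\<dots> = (\<Sum>k<Suc m. (if i = k then if i = m then c else 1 else 0) * R $$ (k, j))"
    proof -
      have "(\<Sum>k<Suc m. (if i = k then if i = m then c else 1 else 0) * R $$ (k, j))
          = (\<Sum>k<Suc m. if i = k then (if i = m then c else 1) * R $$ (k, j) else 0)"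
        by (intro sum.cong) auto
      then show ?thesis using ij by (simp add: R_def del: sum.lessThan_Suc)
    qed
    also have "\<dots> = (D * R) $$ (i, j)"
      using ij carr by (simp add: times_mat_def scalar_prod_def D_def atLeast0LessThan del: sum.lessThan_Suc)
    finally show "(E * A) $$ (i, j) = (D * R) $$ (i, j)" .
  qed (use A carr in auto)
  then have "det E * det A = det D * det R"
    using det_mult[OF carr(1) A] det_mult[OF carr(2,3)] by metis
  then show ?thesis by (simp add: dE dD R_def)
qed

text \<open>The shift by \<open>b\<close> adds \<open>b\<close> times the all-ones last row to every
  other row; \<open>F\<close> is this unipotent row operation.\<close>

lemma det_last_row_one_shift:
  fixes f :: "nat \<Rightarrow> nat \<Rightarrow> 'a :: idom"
  shows "det (mat (Suc m) (Suc m) (\<lambda>(i, j). if i = m then 1 else f i j + b))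
       = det (mat (Suc m) (Suc m) (\<lambda>(i, j). if i = m then 1 else f i j))"
    (is "det ?S = det ?R")
proof -
  define F where
    "F = mat (Suc m) (Suc m) (\<lambda>(i, j). if i = j then 1 else if j = m then b else 0)"
  have carr: "F \<in> carrier_mat (Suc m) (Suc m)" "?R \<in> carrier_mat (Suc m) (Suc m)"
    by (auto simp: F_def)
  have "upper_triangular F" by (auto simp: F_def)
  then have dF: "det F = 1"
    by (subst det_upper_triangular[OF _ carr(1)])
      (auto simp: F_def prod_list_diag_prod intro!: prod.neutral)
  have "?S = F * ?R"
  proof (rule eq_matI)
    fix i j assume "i < dim_row (F * ?R)" "j < dim_col (F * ?R)"
    then have ij: "i < Suc m" "j < Suc m" using carr by auto
    have "(F * ?R) $$ (i, j)
        = (\<Sum>k<Suc m. (if i = k then 1 else if k = m then b else 0) * (if k = m then 1 else f k j))"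
      using ij by (simp add: times_mat_def scalar_prod_def F_def atLeast0LessThan del: sum.lessThan_Suc)
    also have "\<dots> = (\<Sum>k<m. (if i = k then f k j else 0)) + (if i = m then 1 else b)"
      by (simp add: if_distrib[of "\<lambda>x. x * _"] cong: if_cong)
    also have "\<dots> = ?S $$ (i, j)" using ij by (auto simp: less_Suc_eq)
    finally show "?S $$ (i, j) = (F * ?R) $$ (i, j)" by simp
  qed (use carr in auto)
  then show ?thesis using det_mult[OF carr] dF by simp
qed

lemma char_poly_matrix_index:
  assumes "A \<in> carrier_mat n n" "i < n" "j < n"
  shows "char_poly_matrix A $$ (i, j) = [:- A $$ (i, j), if i = j then 1 else 0:]"
  using assms by (auto simp: char_poly_matrix_def)

text \<open>Adding \<open>b\<close> to every entry moves only the eigenvalue of the left eigenvector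
  \<open>(1, \<dots>, 1)\<close>, counted with multiplicity.\<close>

lemma char_poly_const_col_sums_shift:
  fixes f :: "nat \<Rightarrow> nat \<Rightarrow> 'a :: idom"
  assumes c: "\<And>j. j < Suc m \<Longrightarrow> (\<Sum>i<Suc m. f i j) = c"
  obtains r where
    "char_poly (mat (Suc m) (Suc m) (\<lambda>(i, j). f i j)) = [:- c, 1:] * r"
    "char_poly (mat (Suc m) (Suc m) (\<lambda>(i, j). f i j + b)) = [:- (c + of_nat (Suc m) * b), 1:] * r"
proof -
  have gen: "char_poly (mat (Suc m) (Suc m) (\<lambda>(i, j). g i j)) = [:- s, 1:] *
      det (mat (Suc m) (Suc m) (\<lambda>(i, j). if i = m then 1 else [:- g i j, if i = j then 1 else 0:]))"
    if g: "\<And>j. j < Suc m \<Longrightarrow> (\<Sum>i<Suc m. g i j) = s" for g :: "nat \<Rightarrow> nat \<Rightarrow> 'a" and s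
  proof -
    let ?A = "mat (Suc m) (Suc m) (\<lambda>(i, j). g i j)"
    have A: "?A \<in> carrier_mat (Suc m) (Suc m)" by simp
    have sums: "(\<Sum>i<Suc m. char_poly_matrix ?A $$ (i, j)) = [:- s, 1:]" if j: "j < Suc m" for j
    proof (rule poly_eqI)
      fix k
      have "coeff (\<Sum>i<Suc m. char_poly_matrix ?A $$ (i, j)) k
          = (\<Sum>i<Suc m. coeff [:- g i j, if i = j then 1 else 0:] k)"
        unfolding coeff_sum using j
        by (intro sum.cong) (auto simp: char_poly_matrix_index[OF A])
      also have "\<dots> = coeff [:- s, 1:] k"
        using g[OF j] j
        by (auto simp: coeff_pCons sum_negf split: nat.splits simp del: sum.lessThan_Suc)
      finally show "coeff (\<Sum>i<Suc m. char_poly_matrix ?A $$ (i, j)) k = coeff [:- s, 1:] k" .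
    qed
    have "mat (Suc m) (Suc m) (\<lambda>(i, j). if i = m then 1 else char_poly_matrix ?A $$ (i, j))
      = mat (Suc m) (Suc m) (\<lambda>(i, j). if i = m then 1 else [:- g i j, if i = j then 1 else 0:])"
      by (rule eq_matI) (auto simp: char_poly_matrix_index[OF A])
    then show ?thesis
      unfolding char_poly_def
      using det_const_col_sums[OF char_poly_matrix_closed[OF A] sums] by simp
  qed
  let ?f = "\<lambda>i j. [:- f i j, if i = j then 1 else 0:]"
  \<comment> \<open>In the characteristic matrix the shift is the constant polynomial
    \<open>[:- b:]\<close> in every entry, so the two cofactors from \<open>gen\<close> have the
    same determinant, the common \<open>r\<close>.\<close>
  have split: "[:- (f i j + b), if i = j then 1 else 0:] = ?f i j + [:- b:]" for i j by simp
  have "(\<Sum>i<Suc m. f i j + b) = c + of_nat (Suc m) * b" if "j < Suc m" for j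
    using c[OF that] by (simp add: sum.distrib del: sum.lessThan_Suc)
  from gen[of "\<lambda>i j. f i j + b", OF this, unfolded split det_last_row_one_shift] gen[of f, OF c]
  show thesis by (intro that)
qed

section \<open>The spectrum of a weighted Laplacian\<close>

text \<open>Assumption \<open>ev\<close> says that (L + J) v = \<mu> v for the Laplacian L with
  weights \<open>w\<close>; pair it with the conjugate of \<open>v\<close>. The vector is complex
  because \<mu> is not yet known to be real; the real right-hand side will show that it is.\<close>

lemma weighted_laplacian_rayleigh:
  fixes w :: "nat \<Rightarrow> nat \<Rightarrow> real" and v :: "nat \<Rightarrow> complex"
  assumes sym: "\<And>i j. i < n \<Longrightarrow> j < n \<Longrightarrow> w i j = w j i"
    and ev: "\<And>i. i < n \<Longrightarrow> (\<Sum>j<n. w i j * (v i - v j)) + (\<Sum>j<n. v j) = \<mu> * v i"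
  shows "\<mu> * of_real (\<Sum>i<n. (cmod (v i))\<^sup>2) =
    of_real ((\<Sum>i<n. \<Sum>j<n. w i j * (cmod (v i - v j))\<^sup>2) / 2 + (cmod (\<Sum>j<n. v j))\<^sup>2)"
proof -
  define S where "S = (\<Sum>i<n. \<Sum>j<n. w i j * (cnj (v i) * (v i - v j)))"
  \<comment> \<open>By symmetry of \<open>w\<close>, swapping the indices preserves
    \<open>S\<close>. Adding both versions combines the terms for (i, j) into \<open>w i j\<close>
    times the squared modulus of \<open>v i - v j\<close>.\<close>
  have "S = (\<Sum>j<n. \<Sum>i<n. w i j * (cnj (v i) * (v i - v j)))"
    unfolding S_def by (rule sum.swap)
  also have "\<dots> = (\<Sum>i<n. \<Sum>j<n. w i j * (cnj (v j) * (v j - v i)))"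
    using sym by (intro sum.cong refl) auto
  finally have "2 * S = (\<Sum>i<n. \<Sum>j<n. w i j * (cnj (v i) * (v i - v j)))
      + (\<Sum>i<n. \<Sum>j<n. w i j * (cnj (v j) * (v j - v i)))"
    by (simp add: S_def)
  also have "\<dots> = (\<Sum>i<n. \<Sum>j<n. of_real (w i j * (cmod (v i - v j))\<^sup>2))"
    unfolding sum.distrib[symmetric] of_real_mult complex_norm_square
    by (intro sum.cong refl) (simp add: algebra_simps)
  finally have "2 * S = of_real (\<Sum>i<n. \<Sum>j<n. w i j * (cmod (v i - v j))\<^sup>2)"
    unfolding of_real_sum .
  then have S: "S = of_real ((\<Sum>i<n. \<Sum>j<n. w i j * (cmod (v i - v j))\<^sup>2) / 2)"
    by (simp only: of_real_divide) (simp add: eq_divide_eq mult.commute[of S])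
  have "\<mu> * of_real (\<Sum>i<n. (cmod (v i))\<^sup>2) = (\<Sum>i<n. cnj (v i) * (\<mu> * v i))"
    unfolding of_real_sum complex_norm_square sum_distrib_left
    by (intro sum.cong refl) (simp add: algebra_simps)
  also have "\<dots> = (\<Sum>i<n. cnj (v i) * ((\<Sum>j<n. w i j * (v i - v j)) + (\<Sum>j<n. v j)))"
    using ev by (intro sum.cong refl) auto
  also have "\<dots> = S + (\<Sum>j<n. v j) * cnj (\<Sum>j<n. v j)"
    unfolding S_def cnj_sum distrib_left sum.distrib sum_distrib_left sum_distrib_right
    by (intro arg_cong2[of _ _ _ _ "(+)"] sum.cong refl) (simp_all add: algebra_simps)
  finally show ?thesis
    unfolding S complex_norm_square[symmetric] by simp
qed

text \<open>The quadratic form is monotone in the off-diagonal weights, so its Rayleigh quotient is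
  at least the one for unit weights, which is \<open>n\<close>.\<close>

lemma weighted_laplacian_eigenvalue_ge:
  fixes w :: "nat \<Rightarrow> nat \<Rightarrow> real" and v :: "nat \<Rightarrow> complex"
  assumes sym: "\<And>i j. i < n \<Longrightarrow> j < n \<Longrightarrow> w i j = w j i"
    and ge: "\<And>i j. i < n \<Longrightarrow> j < n \<Longrightarrow> i \<noteq> j \<Longrightarrow> 1 \<le> w i j"
    and ev: "\<And>i. i < n \<Longrightarrow> (\<Sum>j<n. w i j * (v i - v j)) + (\<Sum>j<n. v j) = \<mu> * v i"
    and nz: "i0 < n" "v i0 \<noteq> 0"
  shows "\<mu> \<in> \<real>" "real n \<le> Re \<mu>"
proof -
  define N where "N = (\<Sum>i<n. (cmod (v i))\<^sup>2)"
  define Q where "Q w = (\<Sum>i<n. \<Sum>j<n. w i j * (cmod (v i - v j))\<^sup>2) / 2 + (cmod (\<Sum>j<n. v j))\<^sup>2"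
    for w :: "nat \<Rightarrow> nat \<Rightarrow> real"
  have N: "N > 0"
    unfolding N_def using nz by (intro sum_pos2[of _ i0]) auto
  have Q: "\<mu> * of_real N = of_real (Q w)"
    unfolding N_def Q_def by (rule weighted_laplacian_rayleigh[OF sym ev])
  \<comment> \<open>For unit weights L + J is \<open>n\<close> times the identity, so any
    \<open>v\<close> satisfies the eigenvector equation with eigenvalue \<open>n\<close>.\<close>
  have "of_nat n * of_real N = (of_real (Q (\<lambda>_ _. 1)) :: complex)"
    unfolding N_def Q_def
    by (rule weighted_laplacian_rayleigh) (simp_all add: sum_subtractf)
  then have Q1: "real n * N = Q (\<lambda>_ _. 1)"
    by (metis of_real_eq_iff of_real_mult of_real_of_nat_eq)
  have "(1 :: real) * (cmod (v i - v j))\<^sup>2 \<le> w i j * (cmod (v i - v j))\<^sup>2" if "i < n" "j < n" for i j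
    using mult_right_mono[OF ge[OF that]] by (cases "i = j") auto
  then have "Q (\<lambda>_ _. 1) \<le> Q w"
    unfolding Q_def by (intro add_right_mono divide_right_mono sum_mono) auto
  moreover have \<mu>: "\<mu> = of_real (Q w / N)"
    using Q N by (simp add: field_simps)
  moreover have "Re \<mu> = Q w / N" by (subst \<mu>) simp
  ultimately show "real n \<le> Re \<mu>" using Q1 N by (simp add: pos_le_divide_eq)
  show "\<mu> \<in> \<real>" using \<mu> by simp
qed

text \<open>The fundamental theorem of algebra gives a complex root, which is real by assumption and
  splits off a linear factor; roots of the quotient are roots of \<open>p\<close>. Multiplicities
  are thus handled without diagonalising a matrix.\<close>

lemma real_poly_splits:
  fixes p :: "real poly"
  assumes "lead_coeff p = 1"
    and "\<And>z. poly (map_poly complex_of_real p) z = 0 \<Longrightarrow> z \<in> \<real> \<and> c \<le> Re z"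
  obtains rs where "p = (\<Prod>a\<leftarrow>rs. [:- a, 1:])" "\<forall>a\<in>set rs. c \<le> a"
proof -
  interpret map_poly_hom: map_poly_comm_ring_hom complex_of_real ..
  have "\<exists>rs. p = (\<Prod>a\<leftarrow>rs. [:- a, 1:]) \<and> (\<forall>a\<in>set rs. c \<le> a)"
    using assms
  proof (induction "degree p" arbitrary: p)
    case 0
    then have "p = 1" by (metis monic_degree_0)
    then show ?case by (intro exI[of _ "[]"]) auto
  next
    case (Suc d)
    let ?P = "map_poly complex_of_real p"
    have "degree ?P \<noteq> 0" using Suc(2) by simp
    then have "\<not> constant (poly ?P)" by (simp add: constant_degree)
    then obtain z where z: "poly ?P z = 0" using fundamental_theorem_of_algebra by blast
    with Suc.prems(2) have "z \<in> \<real>" and c: "c \<le> Re z" by blast+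
    then have zR: "z = of_real (Re z)" by (simp add: of_real_Re)
    have "complex_of_real (poly p (Re z)) = 0"
      using z zR by (metis of_real_hom.poly_map_poly)
    then have "poly p (Re z) = 0" by simp
    then obtain q where q: "p = [:- Re z, 1:] * q" by (metis dvdE poly_eq_0_iff_dvd)
    have "q \<noteq> 0" using q Suc(2) by auto
    then have "d = degree q"
      using q Suc(2) by (simp add: degree_mult_eq del: mult_pCons_left)
    moreover have "lead_coeff q = 1" using Suc.prems(1) q by (simp add: lead_coeff_mult del: mult_pCons_left)
    moreover have "x \<in> \<real> \<and> c \<le> Re x" if "poly (map_poly complex_of_real q) x = 0" for x
    proof (rule Suc.prems(2))
      show "poly ?P x = 0"
        unfolding q map_poly_hom.hom_mult poly_mult that by simp
    qed
    ultimately obtain rs where "q = (\<Prod>a\<leftarrow>rs. [:- a, 1:])" "\<forall>a\<in>set rs. c \<le> a"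
      using Suc.hyps(1) by blast
    then show ?case using q c by (intro exI[of _ "Re z # rs"]) auto
  qed
  then show thesis using that by blast
qed

text \<open>Every root of the cofactor \<open>r\<close> is an eigenvalue of L + J, where the bound
  \<open>n\<close> holds for all eigenvectors. Working with L itself would require restricting to
  vectors orthogonal to the all-ones vector.\<close>

lemma char_poly_weighted_laplacian:
  fixes w :: "nat \<Rightarrow> nat \<Rightarrow> real"
  assumes sym: "\<And>i j. i < n \<Longrightarrow> j < n \<Longrightarrow> w i j = w j i"
    and ge: "\<And>i j. i < n \<Longrightarrow> j < n \<Longrightarrow> i \<noteq> j \<Longrightarrow> 1 \<le> w i j"
    and n: "n > 0"
  obtains rs where
    "char_poly (mat n n (\<lambda>(i, j). (if i = j then \<Sum>k<n. w i k else 0) - w i j))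
      = pCons 0 (\<Prod>a\<leftarrow>rs. [:- a, 1:])"
    "\<forall>a\<in>set rs. real n \<le> a" "Suc (length rs) = n"
proof -
  interpret map_poly_hom: map_poly_comm_ring_hom complex_of_real ..
  obtain m where m: "n = Suc m" using n by (cases n) auto
  define f where "f i j = (if i = j then \<Sum>k<n. w i k else 0) - w i j" for i j
  let ?L = "mat n n (\<lambda>(i, j). f i j)" and ?M = "mat n n (\<lambda>(i, j). f i j + 1)"
  \<comment> \<open>Row sums vanish by construction; symmetry of \<open>w\<close> transfers this to
    columns.\<close>
  have cs: "(\<Sum>i<Suc m. f i j) = 0" if "j < Suc m" for j
    using that sym unfolding f_def sum_subtractf m by (simp del: sum.lessThan_Suc)
  obtain r where r: "char_poly ?L = [:- 0, 1:] * r" "char_poly ?M = [:- (0 + of_nat n * 1), 1:] * r"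
    unfolding m by (rule char_poly_const_col_sums_shift[of m f 0 1, OF cs])
  have carr: "?L \<in> carrier_mat n n" "?M \<in> carrier_mat n n" by auto
  have rL: "char_poly ?L = pCons 0 r" using r(1) by simp
  have deg: "degree (char_poly ?L) = n" and mon: "lead_coeff (char_poly ?L) = 1"
    using degree_monic_char_poly[OF carr(1)] by auto
  have r0: "r \<noteq> 0" using mon rL by auto
  have lr: "lead_coeff r = 1" using mon rL r0 by simp
  have rt: "z \<in> \<real> \<and> real n \<le> Re z" if z: "poly (map_poly complex_of_real r) z = 0" for z
  proof -
    let ?C = "map_mat complex_of_real ?M"
    have C: "?C \<in> carrier_mat n n" by simp
    have "char_poly ?C = map_poly of_real (char_poly ?M)"
      by (rule of_real_hom.char_poly_hom[OF carr(2)])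
    then have "poly (char_poly ?C) z = 0"
      unfolding r(2) map_poly_hom.hom_mult poly_mult using z by simp
    then have "eigenvalue ?C z" using eigenvalue_root_char_poly[OF C] by blast
    then obtain x where x: "x \<in> carrier_vec n" "x \<noteq> 0\<^sub>v n" "?C *\<^sub>v x = z \<cdot>\<^sub>v x"
      unfolding eigenvalue_def eigenvector_def by auto
    obtain i0 where i0: "i0 < n" "x $ i0 \<noteq> 0"
      using x(1,2) by (metis carrier_vecD eq_vecI index_zero_vec)
    have "(\<Sum>j<n. w i j * (x $ i - x $ j)) + (\<Sum>j<n. x $ j) = z * x $ i" if i: "i < n" for i
    proof -
      have "z * x $ i = (?C *\<^sub>v x) $ i" using x i by auto
      also have "\<dots> = (\<Sum>j<n. of_real (f i j + 1) * x $ j)"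
        using i x(1) by (simp add: scalar_prod_def atLeast0LessThan)
      also have "\<dots> = (\<Sum>j<n. (if i = j then (\<Sum>k<n. of_real (w i k)) * x $ i else 0)
          - of_real (w i j) * x $ j + x $ j)"
        by (intro sum.cong) (auto simp: f_def algebra_simps)
      also have "\<dots> = (\<Sum>j<n. w i j * (x $ i - x $ j)) + (\<Sum>j<n. x $ j)"
        using i by (simp add: sum.distrib sum_subtractf sum_distrib_left algebra_simps)
      finally show ?thesis by simp
    qed
    from weighted_laplacian_eigenvalue_ge[OF sym ge this i0] show ?thesis by auto
  qed
  obtain rs where rs: "r = (\<Prod>a\<leftarrow>rs. [:- a, 1:])" "\<forall>a\<in>set rs. real n \<le> a"
    using real_poly_splits[OF lr rt] by blast
  have "degree r = length rs" unfolding rs(1) by (rule degree_linear_factors)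
  then have "Suc (length rs) = n" using deg rL r0 by simp
  then show thesis using that[OF _ rs(2)] rL rs(1) unfolding f_def by blast
qed

section \<open>Coefficients of products of linear factors\<close>

text \<open>The coefficient is homogeneous of degree \<open>length as - k\<close> in the roots. The
  exponent \<open>length as + k\<close> has the same parity and avoids truncated
  subtraction.\<close>

lemma coeff_prod_linear_factors_uminus:
  "coeff (\<Prod>a\<leftarrow>as. [:- a, 1:]) k
    = (-1) ^ (length as + k) * coeff (\<Prod>a\<leftarrow>as. [:a, 1:]) k" for as :: "'a :: comm_ring_1 list"
proof (induction as arbitrary: k)
  case Nil
  then show ?case by (cases k) auto
next
  case (Cons a as)
  then show ?case by (cases k) (auto simp: coeff_pCons algebra_simps)
qed

lemma coeff_prod_linear_factors_nonneg:
  fixes as :: "real list"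
  assumes "\<forall>a\<in>set as. 0 \<le> a"
  shows "0 \<le> coeff (\<Prod>a\<leftarrow>as. [:a, 1:]) k"
  using assms
proof (induction as arbitrary: k)
  case Nil
  then show ?case by (cases k) auto
next
  case (Cons a as)
  then show ?case by (cases k) (auto simp: coeff_pCons)
qed

text \<open>The case \<open>l = Suc k\<close> is log-concavity; the general form, total positivity of order 2, is what
  multiplication by a linear factor preserves.\<close>

lemma coeff_prod_linear_factors_TP2:
  fixes as :: "real list"
  assumes "\<forall>a\<in>set as. 0 \<le> a" "k \<le> l"
  shows "coeff (\<Prod>a\<leftarrow>as. [:a, 1:]) k * coeff (\<Prod>a\<leftarrow>as. [:a, 1:]) (Suc l)
       \<le> coeff (\<Prod>a\<leftarrow>as. [:a, 1:]) (Suc k) * coeff (\<Prod>a\<leftarrow>as. [:a, 1:]) l"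
  using assms
proof (induction as arbitrary: k l)
  case Nil
  then show ?case by simp
next
  case (Cons a as)
  define c where "c = coeff (\<Prod>a\<leftarrow>as. [:a, 1:])"
  have a: "0 \<le> a" using Cons.prems by simp
  have TP: "c k * c (Suc l) \<le> c (Suc k) * c l" if "k \<le> l" for k l
    using Cons that by (simp add: c_def)
  have c0: "0 \<le> c k" for k
    using Cons.prems coeff_prod_linear_factors_nonneg[of as] by (simp add: c_def)
  have cS: "coeff (\<Prod>a\<leftarrow>a # as. [:a, 1:]) (Suc k) = a * c (Suc k) + c k" for k
    by (simp add: c_def)
  have c00: "coeff (\<Prod>a\<leftarrow>a # as. [:a, 1:]) 0 = a * c 0"
    by (simp add: c_def)
  show ?case
  proof (cases "k = l")
    case False
    then obtain l' where l: "l = Suc l'" "k \<le> l'" using Cons.prems(2) by (cases l) auto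
    have 1: "a\<^sup>2 * (c k * c (Suc l)) \<le> a\<^sup>2 * (c (Suc k) * c l)"
      using TP[of k l] l by (intro mult_left_mono) auto
    show ?thesis
    proof (cases k)
      case 0
      have "0 \<le> a * (c 1 * c l') + c 0 * c l'" using a c0 by simp
      then show ?thesis using 1 unfolding 0 l cS c00
        by (simp add: algebra_simps power2_eq_square)
    next
      case (Suc k')
      have "c k' * c l \<le> c k * c l'" using TP[of k' l'] l Suc by simp
      \<comment> \<open>This compares the terms linear in \<open>a\<close> after
        \<open>a * (c k * c l)\<close> cancels. The chain through \<open>c k * c l\<close> uses two
        instances of \<open>TP\<close> with different gaps, hence the general \<open>k\<close> and
        \<open>l\<close>.\<close>
      moreover have "c k' * c (Suc l) \<le> c (Suc k) * c l'"
        using TP[of k' l] TP[of k l'] l Suc by simp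
      then have "a * (c k' * c (Suc l)) \<le> a * (c (Suc k) * c l')"
        using a by (rule mult_left_mono)
      ultimately show ?thesis using 1 unfolding Suc l cS
        by (simp add: algebra_simps power2_eq_square)
    qed
  qed simp
qed

text \<open>The difference of the two sides is the coefficient of \<open>m p - (x + c) p'\<close> with
  \<open>m = length as\<close>, which equals the sum of \<open>(a - c) p / (x + a)\<close> over the factors.\<close>

lemma coeff_prod_linear_factors_growth:
  fixes as :: "real list"
  assumes "\<forall>a\<in>set as. c \<le> a" "0 \<le> c"
  shows "c * (real (Suc k) * coeff (\<Prod>a\<leftarrow>as. [:a, 1:]) (Suc k))
       \<le> (real (length as) - real k) * coeff (\<Prod>a\<leftarrow>as. [:a, 1:]) k"
  using assms(1)
proof (induction as arbitrary: k)
  case Nil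
  then show ?case by (cases k) auto
next
  case (Cons a as)
  define e where "e = coeff (\<Prod>a\<leftarrow>as. [:a, 1:])"
  define m where "m = real (length as)"
  have a: "c \<le> a" using Cons.prems by simp
  have IH: "c * (real (Suc k) * e (Suc k)) \<le> (m - real k) * e k" for k
    using Cons by (simp add: e_def m_def)
  have e0: "0 \<le> e k" for k
    using Cons.prems assms(2) coeff_prod_linear_factors_nonneg[of as]
    by (auto simp: e_def intro: order_trans)
  have 1: "a * (c * (real (Suc k) * e (Suc k))) \<le> a * ((m - real k) * e k)"
    using IH[of k] a assms(2) by (intro mult_left_mono) auto
  have 2: "c * e k \<le> a * e k" using a e0 by (intro mult_right_mono) auto
  have cS: "coeff (\<Prod>a\<leftarrow>a # as. [:a, 1:]) (Suc k) = a * e (Suc k) + e k" for k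
    by (simp add: e_def)
  have c00: "coeff (\<Prod>a\<leftarrow>a # as. [:a, 1:]) 0 = a * e 0"
    by (simp add: e_def)
  have len: "real (length (a # as)) = m + 1" by (simp add: m_def)
  show ?case
  proof (cases k)
    case 0
    show ?thesis using 1 2 unfolding 0 cS c00 len by (simp add: algebra_simps)
  next
    case (Suc k')
    \<comment> \<open>The three inequalities add up to the claim: 2 supplies the one
      \<open>c * e k\<close> by which the factor \<open>Suc k\<close> exceeds the factor
      \<open>k\<close> in the hypothesis at \<open>k'\<close>.\<close>
    show ?thesis using 1 2 IH[of k'] unfolding Suc cS len by (simp add: algebra_simps)
  qed
qed

section \<open>The distance Laplacian\<close>

theorem theorem5p3:
  fixes G :: "('a, 'b) pre_digraph" and vs :: "'a list" and n :: nat
    and \<delta> :: "nat \<Rightarrow> real"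
  assumes "graph G" and "Digraph_Component.connected G"
    and "distinct vs" and "set vs = verts G"
    and "n = card (verts G)"
    and "\<delta> = coeff (char_poly (distance_laplacian G vs))"
  shows "char_poly (distance_laplacian G vs) = (\<Sum>k = 1..n. monom (\<delta> k) k)
    \<and> \<delta> n = 1
    \<and> log_concave_seq n \<delta>
    \<and> unimodal_seq n (\<lambda>k. \<bar>\<delta> k\<bar>)
    \<and> (\<forall>k. 1 \<le> k \<and> k < n \<longrightarrow> \<bar>\<delta> k\<bar> \<ge> \<bar>\<delta> (k + 1)\<bar>)"
proof -
  interpret graph G by fact
  have sc: "strongly_connected G"
    using symmetric_connected_imp_strongly_connected[OF sym_arcs assms(2)] .
  have len: "length vs = n" using assms(3,4,5) distinct_card by metis
  define w where "w i j = real (graph_dist G (vs ! i) (vs ! j))" for i j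
  have vs: "vs ! i \<in> verts G" if "i < n" for i
    using that len assms(4) nth_mem by metis
  have reach: "vs ! i \<rightarrow>\<^sup>*\<^bsub>G\<^esub> vs ! j" if "i < n" "j < n" for i j
    using sc vs that by (auto simp: strongly_connected_def)
  have n: "n > 0"
    using sc assms(5) by (simp add: strongly_connected_def card_gt_0_iff)
  have sym: "w i j = w j i" if "i < n" "j < n" for i j
    using graph_dist_commute[OF reach[OF that]] by (simp add: w_def)
  have ge: "1 \<le> w i j" if "i < n" "j < n" "i \<noteq> j" for i j
  proof -
    have "vs ! i \<noteq> vs ! j" using that len assms(3) by (simp add: nth_eq_iff_index_eq)
    then show ?thesis using graph_dist_pos[OF reach[OF that(1,2)]] by (simp add: w_def)
  qed
  have "real (transmission G (vs ! i)) = (\<Sum>k<n. w i k)" for i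
  proof -
    have "transmission G (vs ! i) = (\<Sum>u\<leftarrow>vs. graph_dist G (vs ! i) u)"
      unfolding transmission_def assms(4)[symmetric]
      using assms(3) by (simp add: sum_list_distinct_conv_sum_set)
    also have "\<dots> = (\<Sum>k<n. graph_dist G (vs ! i) (vs ! k))"
      by (simp add: sum_list_sum_nth len atLeast0LessThan)
    finally show ?thesis by (simp add: w_def)
  qed
  then have L: "distance_laplacian G vs
      = mat n n (\<lambda>(i, j). (if i = j then \<Sum>k<n. w i k else 0) - w i j)"
    unfolding distance_laplacian_def distance_matrix_def len
    by (intro eq_matI) (auto simp: mat_diag_def w_def)
  obtain rs where p: "char_poly (distance_laplacian G vs) = pCons 0 (\<Prod>a\<leftarrow>rs. [:- a, 1:])"
    and rs: "\<forall>a\<in>set rs. real n \<le> a" and len_rs: "Suc (length rs) = n"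
    unfolding L by (rule char_poly_weighted_laplacian[of n w, OF sym ge n])
  \<comment> \<open>\<open>e k\<close> will be the absolute value of
    \<open>\<delta> (Suc k)\<close>: the factor x shifts the index by one, and negating the
    nonnegative roots removes the signs.\<close>
  define e where "e = coeff (\<Prod>a\<leftarrow>rs. [:a, 1:])"
  have rs0: "\<forall>a\<in>set rs. 0 \<le> a" using rs by (metis of_nat_0_le_iff order_trans)
  have e0: "0 \<le> e k" for k
    unfolding e_def by (rule coeff_prod_linear_factors_nonneg[OF rs0])
  have \<delta>0: "\<delta> 0 = 0" unfolding assms(6) p by simp
  have \<delta>S: "\<delta> (Suc k) = (-1) ^ (length rs + k) * e k" for k
    unfolding assms(6) p e_def by (simp add: coeff_prod_linear_factors_uminus)
  have abs: "\<bar>\<delta> (Suc k)\<bar> = e k" for k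
    using e0[of k] by (simp add: \<delta>S abs_mult)
  have carr: "distance_laplacian G vs \<in> carrier_mat n n" unfolding L by simp
  note deg = degree_monic_char_poly[OF carr]
  have "char_poly (distance_laplacian G vs) = (\<Sum>k\<le>n. monom (\<delta> k) k)"
    unfolding assms(6) using deg poly_as_sum_of_monoms by metis
  also have "{..n} = insert 0 {1..n}" by auto
  finally have 1: "char_poly (distance_laplacian G vs) = (\<Sum>k = 1..n. monom (\<delta> k) k)"
    by (simp add: \<delta>0)
  have 2: "\<delta> n = 1" unfolding assms(6) using deg by simp
  have dec: "\<bar>\<delta> (k + 1)\<bar> \<le> \<bar>\<delta> k\<bar>" if "1 \<le> k" "k < n" for k
  proof -
    obtain i where i: "k = Suc i" using \<open>1 \<le> k\<close> by (cases k) auto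
    \<comment> \<open>The growth bound is weakened at both ends, by 1 \<le> \<open>Suc i\<close> and
      n - 1 - i \<le> n, so that the positive factor \<open>n\<close> cancels.\<close>
    have "real n * e (Suc i) \<le> real n * (real (Suc i) * e (Suc i))"
      using e0[of "Suc i"] by (intro mult_left_mono) (auto simp: algebra_simps)
    also have "\<dots> \<le> (real (length rs) - real i) * e i"
      using coeff_prod_linear_factors_growth[OF rs, of i] by (simp add: e_def)
    also have "\<dots> \<le> real n * e i"
      using e0 len_rs by (intro mult_right_mono) auto
    finally show ?thesis using n i abs by simp
  qed
  have "\<delta> (j - 1) * \<delta> (j + 1) \<le> (\<delta> j)\<^sup>2" if "2 \<le> j" for j
  proof -
    obtain i where i: "j = Suc (Suc i)" using \<open>2 \<le> j\<close> by (metis add_2_eq_Suc le_Suc_ex)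
    \<comment> \<open>The indices differ by two, so both coefficients carry the same sign.\<close>
    have "\<delta> (j - 1) * \<delta> (j + 1) = e i * e (Suc (Suc i))"
      using \<delta>S[of i] \<delta>S[of "Suc (Suc i)"] i by (simp add: algebra_simps flip: power_add mult_2)
    also have "\<dots> \<le> e (Suc i) * e (Suc i)"
      unfolding e_def by (rule coeff_prod_linear_factors_TP2[OF rs0]) simp
    also have "\<dots> = (\<delta> j)\<^sup>2"
      using abs[of "Suc i"] i by (metis power2_abs power2_eq_square)
    finally show ?thesis .
  qed
  then have 3: "log_concave_seq n \<delta>" by (auto simp: log_concave_seq_def)
  \<comment> \<open>The sequence is decreasing, so its peak is at index 1 and the ascending part is
    empty.\<close>
  have 4: "unimodal_seq n (\<lambda>k. \<bar>\<delta> k\<bar>)"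
    unfolding unimodal_seq_def using n dec by (intro bexI[of _ 1]) auto
  show ?thesis using 1 2 3 4 dec by blast
qed

end
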